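(* Let $C_1$ and $C_2$ be linked compact sets in $\mathbb{R}^d$ with $\tau(C_1)\,\tau(C_2)>1$. Then $C_1\cap C_2\neq\emptyset$.
   Context: $\operatorname{dist}$ is Euclidean distance and $\partial U$ is the boundary of $U$. Gaps and thickness in $\mathbb{R}^d$. For a compact set $C\subset\mathbb{R}^d$, let $(G_n)_n$ be the (at most countably many, possibly finitely many) bounded open path-connected components of $\mathbb{R}^d\setminus C$, ordered by non-increasing diameter (the order among equal diameters is irrelevant), and let $E$ be the unbounded open path-connected component of $\mathbb{R}^d\setminus C$ (when $d=1$, $E$ is the union of the two unbounded intervals). The sets $E$ and $G_n$ are called the gaps of $C$. If $E$ is not the only component of $\mathbb{R}^d\setminus C$, the thickness of $C$ is $$\tau(C):=\inf_n\frac{\operatorname{dist}\big(G_n,\ \bigcup_{1\le i\le n-1}G_i\cup E\big)}{\operatorname{diam}(G_n)},$$ the infimum being over the index set of the $G_n$. If $E$ is the only component, $\tau(C):=+\infty$ when $C$ has non-empty interior and $\tau(C):=0$ when $C$ has empty interior. Linked gaps. Sets $U,V\subseteq\mathbb{R}^d$ are linked gaps if $U\cap V\ne\emptyset$, $(\partial U)\setminus V\ne\emptyset$ and $(\partial V)\setminus U\neq\emptyset$. Compact sets $C_1,C_2\subset\mathbb{R}^d$ are linked compact sets if for every gap $G^1$ of $C_1$ and every gap $G^2$ of $C_2$ (the unbounded gaps included), either $G^1\cap G^2=\emptyset$ or $G^1,G^2$ are linked gaps. *)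

theory Defs
  imports "HOL-Analysis.Analysis"
begin

definition path_components :: "'a::topological_space set \<Rightarrow> 'a set set" where
  "path_components S = path_component_set S ` S"

definition bounded_gaps :: "'a::euclidean_space set \<Rightarrow> 'a set set" where
  "bounded_gaps C = {U \<in> path_components (- C). bounded U}"

text \<open>For compact C in dimension at least two, exactly one component of the complement is
  unbounded; on the line the union below is that of the two unbounded intervals (or the whole line
  if C is empty).\<close>

definition unbounded_gap :: "'a::euclidean_space set \<Rightarrow> 'a set" where
  "unbounded_gap C = \<Union>{U \<in> path_components (- C). \<not> bounded U}"

definition gaps :: "'a::euclidean_space set \<Rightarrow> 'a set set" where
  "gaps C = insert (unbounded_gap C) (bounded_gaps C)"

text \<open>The bounded gaps, listed without repetition by non-increasing diameter, as a finite or
  infinite sequence indexed from 0.\<close>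

definition gap_enumeration :: "'a::euclidean_space set \<Rightarrow> nat set \<Rightarrow> (nat \<Rightarrow> 'a set) \<Rightarrow> bool" where
  "gap_enumeration C I G \<longleftrightarrow>
     (I = UNIV \<or> (\<exists>m. I = {..<m})) \<and> bij_betw G I (bounded_gaps C) \<and>
     (\<forall>i\<in>I. \<forall>j\<in>I. i \<le> j \<longrightarrow> diameter (G j) \<le> diameter (G i))"

definition thickness_along ::
  "'a::euclidean_space set \<Rightarrow> nat set \<Rightarrow> (nat \<Rightarrow> 'a set) \<Rightarrow> ennreal" where
  "thickness_along C I G =
     (INF n\<in>I. ennreal (setdist (G n) ((\<Union>i<n. G i) \<union> unbounded_gap C) / diameter (G n)))"

text \<open>The value does not depend on the chosen enumeration (\<open>thickness_eq_along\<close> below).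
  A compact set can fail to have an enumeration by non-increasing diameter: for instance if the
  diameters of its gaps increase strictly to a limit.  Then, for some \<open>\<epsilon> > 0\<close>, infinitely many gaps
  have diameter at least \<open>\<epsilon>\<close>, and as they lie in a bounded set, their mutual distances get
  arbitrarily small; the thickness is 0.  That this is the right value is confirmed by
  \<open>thickness_eq_INF\<close> below, an ordering-free formula which is valid in all cases.
  In a product of thicknesses, ennreal arithmetic gives \<open>0 * \<infinity> = 0\<close>.\<close>

definition thickness :: "'a::euclidean_space set \<Rightarrow> ennreal" where
  "thickness C =
     (if bounded_gaps C = {} then (if interior C = {} then 0 else \<infinity>)
      else if \<exists>I G. gap_enumeration C I G
      then (case (SOME (I, G). gap_enumeration C I G) of (I, G) \<Rightarrow> thickness_along C I G)
      else 0)"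

definition linked_gaps :: "'a::euclidean_space set \<Rightarrow> 'a set \<Rightarrow> bool" where
  "linked_gaps U V \<longleftrightarrow> U \<inter> V \<noteq> {} \<and> frontier U - V \<noteq> {} \<and> frontier V - U \<noteq> {}"

definition linked_sets :: "'a::euclidean_space set \<Rightarrow> 'a set \<Rightarrow> bool" where
  "linked_sets C1 C2 \<longleftrightarrow>
     (\<forall>U\<in>gaps C1. \<forall>V\<in>gaps C2. U \<inter> V = {} \<or> linked_gaps U V)"


lemma path_components_eq_components:
  fixes S :: "'a::real_normed_vector set"
  assumes "open S"
  shows "path_components S = components S"
  unfolding path_components_def components_def
  using assms by (simp add: open_path_connected_component_set)

lemma unbounded_gap_eq_outside:
  fixes C :: "'a::euclidean_space set"
  assumes "compact C"
  shows "unbounded_gap C = outside C"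
proof -
  have "open (- C)" using assms by (simp add: compact_imp_closed open_Compl)
  then have *: "path_components (- C) = components (- C)"
    by (rule path_components_eq_components)
  show ?thesis
  proof (intro set_eqI iffI)
    fix x assume "x \<in> unbounded_gap C"
    then obtain y where y: "x \<in> connected_component_set (- C) y"
        "\<not> bounded (connected_component_set (- C) y)"
      unfolding unbounded_gap_def * components_def by auto
    then have "connected_component_set (- C) y = connected_component_set (- C) x"
      using connected_component_eq by metis
    with y show "x \<in> outside C"
      unfolding outside_def using connected_component_in by fastforce
  next
    fix x assume "x \<in> outside C"
    then have x: "x \<in> - C" "\<not> bounded (connected_component_set (- C) x)"
      by (auto simp: outside_def)
    then have "x \<in> connected_component_set (- C) x" by simp
    with x show "x \<in> unbounded_gap C"
      unfolding unbounded_gap_def * components_def by blast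
  qed
qed

lemma unbounded_gap_in_path_components:
  fixes C :: "'a::euclidean_space set"
  assumes "compact C" and "2 \<le> DIM('a)"
  shows "unbounded_gap C \<in> path_components (- C)"
proof -
  have bdd: "bounded (- (- C))" using assms by (simp add: compact_imp_bounded)
  have op: "open (- C)" using assms by (simp add: compact_imp_closed open_Compl)
  have *: "path_components (- C) = components (- C)"
    using op by (rule path_components_eq_components)
  obtain U where U: "U \<in> components (- C)" "\<not> bounded U"
    using cobounded_unbounded_components[OF bdd] by blast
  have uniq: "V = U" if "V \<in> components (- C)" "\<not> bounded V" for V
    using cobounded_unique_unbounded_components[OF bdd that U assms(2)] by simp
  have "{V \<in> components (- C). \<not> bounded V} = {U}"
  proof (intro set_eqI iffI)
    fix V assume "V \<in> {V \<in> components (- C). \<not> bounded V}"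
    with uniq show "V \<in> {U}" by simp
  qed (use U in simp)
  then have "unbounded_gap C = U"
    unfolding unbounded_gap_def * by simp
  with U(1) show ?thesis unfolding * by simp
qed

lemma unbounded_gap_nonempty:
  fixes C :: "'a::euclidean_space set"
  assumes "compact C"
  shows "unbounded_gap C \<noteq> {}"
proof -
  have "\<not> bounded (- C)"
    using assms compact_imp_bounded cobounded_imp_unbounded by blast
  then have "outside C \<noteq> {}"
    using assms compact_imp_bounded outside_bounded_nonempty by blast
  with assms show ?thesis by (simp add: unbounded_gap_eq_outside)
qed

lemma bounded_gap_open:
  assumes "compact C" "U \<in> bounded_gaps C"
  shows "open U" "U \<noteq> {}" "bounded U" "U \<subseteq> - C"
proof -
  have op: "open (- C)" using assms by (simp add: compact_imp_closed open_Compl)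
  have U: "U \<in> components (- C)" "bounded U"
    using assms(2) path_components_eq_components[OF op] by (auto simp: bounded_gaps_def)
  show "open U" "U \<noteq> {}" "bounded U" "U \<subseteq> - C"
    using U op open_components in_components_nonempty in_components_subset by blast+
qed

lemma bounded_gap_diameter_pos:
  assumes "compact C" "U \<in> bounded_gaps C"
  shows "0 < diameter U"
proof -
  obtain x where "x \<in> U" using bounded_gap_open(2)[OF assms] by blast
  then obtain e where "e > 0" "ball x e \<subseteq> U"
    using bounded_gap_open(1)[OF assms] openE by blast
  then have "diameter (ball x e) \<le> diameter U"
    using bounded_gap_open(3)[OF assms] diameter_subset by blast
  with \<open>e > 0\<close> show ?thesis by (simp add: diameter_ball)
qed

lemma thickness_along_eq_INF:
  fixes C :: "'a::euclidean_space set"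
  assumes C: "compact C" and G: "gap_enumeration C I G"
  shows "thickness_along C I G =
    (INF U\<in>bounded_gaps C. ennreal (setdist U
       (\<Union>{V \<in> bounded_gaps C. V \<noteq> U \<and> diameter U \<le> diameter V} \<union> unbounded_gap C)
         / diameter U))"
    (is "?L = (INF U\<in>_. ennreal (setdist U (?B U) / _))")
proof (rule antisym)
  let ?E = "unbounded_gap C"
  have E: "?E \<noteq> {}" by (rule unbounded_gap_nonempty[OF C])
  have I: "i \<in> I" if "i \<le> n" "n \<in> I" for i n
    using G that by (auto simp: gap_enumeration_def)
  have bij: "bij_betw G I (bounded_gaps C)"
    and mono: "\<And>i j. i \<in> I \<Longrightarrow> j \<in> I \<Longrightarrow> i \<le> j \<Longrightarrow> diameter (G j) \<le> diameter (G i)"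
    using G by (auto simp: gap_enumeration_def)
  have img: "G ` I = bounded_gaps C" and inj: "inj_on G I"
    using bij by (auto simp: bij_betw_def)
  have le: "?L \<le> ennreal (setdist (G n) ((\<Union>i<n. G i) \<union> ?E) / diameter (G n))"
    if "n \<in> I" for n
    unfolding thickness_along_def using that by (rule INF_lower)
  show "?L \<le> (INF U\<in>bounded_gaps C. ennreal (setdist U (?B U) / diameter U))"
  proof (rule INF_greatest)
    fix U assume U: "U \<in> bounded_gaps C"
    then obtain n where n: "n \<in> I" "U = G n" using img by auto
    have dU: "diameter U > 0" and neU: "U \<noteq> {}"
      using bounded_gap_diameter_pos[OF C U] bounded_gap_open[OF C U] by auto
    have pt: "?L \<le> ennreal (dist x y / diameter U)" if x: "x \<in> U" and y: "y \<in> ?B U" for x y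
    proof -
      consider "y \<in> ?E" | V where "V \<in> bounded_gaps C" "V \<noteq> U" "diameter U \<le> diameter V" "y \<in> V"
        using y by auto
      then show ?thesis
      proof cases
        case 1
        then have "setdist (G n) ((\<Union>i<n. G i) \<union> ?E) \<le> dist x y"
          using x n by (intro setdist_le_dist) auto
        then show ?thesis
          unfolding n(2) using dU n(2)
          by (intro order_trans[OF le[OF n(1)]] ennreal_leI divide_right_mono) auto
      next
        case 2
        then obtain m where m: "m \<in> I" "V = G m" using img by auto
        show ?thesis
        proof (cases "m < n")
          case True
          then have "setdist (G n) ((\<Union>i<n. G i) \<union> ?E) \<le> dist x y"
            using x n 2 m by (intro setdist_le_dist) auto
          then show ?thesis
            unfolding n(2) using dU n(2)
            by (intro order_trans[OF le[OF n(1)]] ennreal_leI divide_right_mono) auto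
        next
          case False
          with 2 m n have "n < m" by (metis linorder_neqE_nat)
          then have eq: "diameter (G m) = diameter (G n)"
            using mono[OF n(1) m(1)] 2 m n by simp
          have "setdist (G m) ((\<Union>i<m. G i) \<union> ?E) \<le> dist y x"
            using x n 2 m \<open>n < m\<close> by (intro setdist_le_dist) auto
          then have "setdist (G m) ((\<Union>i<m. G i) \<union> ?E) / diameter (G m) \<le> dist x y / diameter U"
            using dU eq n(2) by (simp add: dist_commute divide_right_mono)
          then show ?thesis
            by (rule order_trans[OF le[OF m(1)] ennreal_leI])
        qed
      qed
    qed
    have neB: "?B U \<noteq> {}" using E by auto
    obtain x0 y0 where "x0 \<in> U" "y0 \<in> ?B U" using neU neB by blast
    from pt[OF this] have "?L \<noteq> top" by (auto simp: top_unique)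
    then obtain l where l: "l \<ge> 0" "?L = ennreal l" by (cases "?L") auto
    have "l * diameter U \<le> setdist U (?B U)"
    proof (rule le_setdistI[OF neU neB])
      fix x y assume "x \<in> U" "y \<in> ?B U"
      then have "ennreal l \<le> ennreal (dist x y / diameter U)" using pt l by simp
      then have "l \<le> dist x y / diameter U" using dU by (simp add: ennreal_le_iff)
      then show "l * diameter U \<le> dist x y" using dU by (simp add: pos_le_divide_eq)
    qed
    then show "?L \<le> ennreal (setdist U (?B U) / diameter U)"
      using l dU by (simp add: ennreal_leI pos_le_divide_eq)
  qed
  show "(INF U\<in>bounded_gaps C. ennreal (setdist U (?B U) / diameter U)) \<le> ?L"
    unfolding thickness_along_def
  proof (rule INF_greatest)
    fix n assume n: "n \<in> I"
    then have U: "G n \<in> bounded_gaps C" using img by auto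
    have "G i \<in> bounded_gaps C \<and> G i \<noteq> G n \<and> diameter (G n) \<le> diameter (G i)" if "i < n" for i
      using I[of i n] that n img mono[of i n] inj by (auto simp: inj_on_def)
    then have "(\<Union>i<n. G i) \<union> ?E \<subseteq> ?B (G n)" by blast
    then have "setdist (G n) (?B (G n)) \<le> setdist (G n) ((\<Union>i<n. G i) \<union> ?E)"
      using E by (intro setdist_subset_right) auto
    then have "ennreal (setdist (G n) (?B (G n)) / diameter (G n))
       \<le> ennreal (setdist (G n) ((\<Union>i<n. G i) \<union> ?E) / diameter (G n))"
      using bounded_gap_diameter_pos[OF C U] by (intro ennreal_leI divide_right_mono) auto
    then show "(INF U\<in>bounded_gaps C. ennreal (setdist U (?B U) / diameter U)) \<le> \<dots>"
      using INF_lower[OF U] by (rule order_trans[rotated])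
  qed
qed

lemma thickness_eq_along:
  fixes C :: "'a::euclidean_space set"
  assumes "compact C" "bounded_gaps C \<noteq> {}" "gap_enumeration C I G"
  shows "thickness C = thickness_along C I G"
proof -
  obtain I' G' where eq: "(SOME (I, G). gap_enumeration C I G) = (I', G')" by fastforce
  have "case (I', G') of (I, G) \<Rightarrow> gap_enumeration C I G"
    unfolding eq[symmetric] by (rule someI[of _ "(I, G)"]) (use assms in simp)
  then have "thickness_along C I' G' = thickness_along C I G"
    using thickness_along_eq_INF[OF assms(1)] assms(3) by simp
  with eq assms show ?thesis by (auto simp: thickness_def)
qed

lemma decreasing_enumeration:
  fixes f :: "'b \<Rightarrow> real"
  assumes pos: "\<And>a. a \<in> A \<Longrightarrow> 0 < f a"
    and fin: "\<And>e. e > 0 \<Longrightarrow> finite {a \<in> A. e \<le> f a}"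
  shows "\<exists>I G. (I = UNIV \<or> (\<exists>m::nat. I = {..<m})) \<and> bij_betw G I A \<and>
     (\<forall>i\<in>I. \<forall>j\<in>I. i \<le> j \<longrightarrow> f (G j) \<le> f (G i))"
proof (cases "finite A")
  case True
  then obtain xs where xs: "set xs = A" "distinct xs" using finite_distinct_list by blast
  define ys where "ys = sort_key (\<lambda>a. - f a) xs"
  have ys: "set ys = A" "distinct ys" "sorted (map (\<lambda>a. - f a) ys)"
    using xs by (auto simp: ys_def)
  have "bij_betw ((!) ys) {..<length ys} A" using ys by (intro bij_betw_nth) auto
  moreover have "\<forall>i\<in>{..<length ys}. \<forall>j\<in>{..<length ys}. i \<le> j \<longrightarrow> f (ys ! j) \<le> f (ys ! i)"
    using ys(3) by (auto simp: sorted_iff_nth_mono)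
  ultimately show ?thesis by blast
next
  case False
  have max: "\<exists>a\<in>S. \<forall>b\<in>S. f b \<le> f a" if S: "S \<subseteq> A" "S \<noteq> {}" for S
  proof -
    obtain a where a: "a \<in> S" using S by blast
    let ?T = "{b \<in> S. f a \<le> f b}"
    have "finite {b \<in> A. f a \<le> f b}" using fin[OF pos] S a by blast
    moreover have "?T \<subseteq> {b \<in> A. f a \<le> f b}" using S by auto
    ultimately have T: "finite ?T" "?T \<noteq> {}"
      using a finite_subset by blast+
    then have "Max (f ` ?T) \<in> f ` ?T" by (intro Max_in) auto
    then obtain c where c: "c \<in> ?T" "f c = Max (f ` ?T)" by auto
    have "f b \<le> f c" if "b \<in> S" for b
    proof (cases "f a \<le> f b")
      case True
      with that T show ?thesis unfolding c(2) by (intro Max_ge) auto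
    qed (use c in auto)
    with c(1) show ?thesis by blast
  qed
  define pick where "pick S = (SOME a. a \<in> S \<and> (\<forall>b\<in>S. f b \<le> f a))" for S
  have pick: "pick S \<in> S" "\<And>b. b \<in> S \<Longrightarrow> f b \<le> f (pick S)" if "S \<subseteq> A" "S \<noteq> {}" for S
  proof -
    have "\<exists>a. a \<in> S \<and> (\<forall>b\<in>S. f b \<le> f a)" using max[OF that] by (simp add: Bex_def)
    then have "pick S \<in> S \<and> (\<forall>b\<in>S. f b \<le> f (pick S))"
      unfolding pick_def by (rule someI_ex)
    then show "pick S \<in> S" "\<And>b. b \<in> S \<Longrightarrow> f b \<le> f (pick S)" by auto
  qed
  define S where "S = rec_nat A (\<lambda>_ S. S - {pick S})"
  have S0: "S 0 = A" and SS: "\<And>n. S (Suc n) = S n - {pick (S n)}" by (auto simp: S_def)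
  define G where "G n = pick (S n)" for n
  have inf: "infinite (S n)" for n by (induction n) (auto simp: S0 SS False)
  have anti: "S n \<subseteq> S m" if "m \<le> n" for m n
    using lift_Suc_antimono_le[of S m n] that by (auto simp: SS)
  have sub: "S n \<subseteq> A" "S n \<noteq> {}" for n using anti[of 0 n] inf[of n] S0 by auto
  have GS: "G n \<in> S n" "\<And>b. b \<in> S n \<Longrightarrow> f b \<le> f (G n)" for n
    using pick[OF sub] by (auto simp: G_def)
  have later: "G n \<in> S m - {G m}" if "m < n" for m n
    using anti[of "Suc m" n] that GS(1)[of n] by (auto simp: SS G_def)
  have inj: "inj G"
  proof (rule linorder_injI)
    fix m n :: nat assume "m < n"
    from later[OF this] show "G m \<noteq> G n" by auto
  qed
  have mono: "f (G j) \<le> f (G i)" if "i \<le> j" for i j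
  proof -
    have "G j \<in> S i" using anti[OF that] GS(1) by (rule subsetD)
    then show ?thesis by (rule GS(2))
  qed
  have "a \<in> range G" if a: "a \<in> A" for a
  proof (rule ccontr)
    assume na: "a \<notin> range G"
    have "a \<in> S n" for n
    proof (induction n)
      case (Suc n)
      have "a \<noteq> pick (S n)" using na by (metis G_def rangeI)
      with Suc show ?case by (simp add: SS)
    qed (simp add: S0 a)
    then have "range G \<subseteq> {b \<in> A. f a \<le> f b}" using GS sub by blast
    then have "finite (range G)" using fin[OF pos[OF a]] by (rule finite_subset)
    then show False using inj by (simp add: finite_image_iff)
  qed
  moreover have "range G \<subseteq> A" using GS(1) sub by blast
  ultimately have "bij_betw G UNIV A" using inj by (auto simp: bij_betw_def)
  with mono show ?thesis by blast
qed

lemma infinite_bounded_close_pair: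
  fixes p :: "'b \<Rightarrow> 'a::euclidean_space"
  assumes "infinite A" "bounded (p ` A)" "d > 0"
  shows "\<exists>a\<in>A. \<exists>b\<in>A. a \<noteq> b \<and> dist (p a) (p b) < d"
proof (rule ccontr)
  assume neg: "\<not> ?thesis"
  have "compact (closure (p ` A))" using assms by simp
  then obtain k where k: "finite k" "closure (p ` A) \<subseteq> (\<Union>x\<in>k. ball x (d/2))"
    using assms(3) compact_eq_totally_bounded by (metis half_gt_zero)
  have "\<forall>a\<in>A. \<exists>x\<in>k. p a \<in> ball x (d/2)" using k(2) closure_subset by blast
  then obtain c where c: "\<And>a. a \<in> A \<Longrightarrow> c a \<in> k \<and> p a \<in> ball (c a) (d/2)" by metis
  have "inj_on c A"
  proof (rule inj_onI, rule ccontr)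
    fix a b assume ab: "a \<in> A" "b \<in> A" "c a = c b" "a \<noteq> b"
    have "dist (c a) (p a) < d / 2" "dist (c a) (p b) < d / 2"
      using c[OF ab(1)] c[OF ab(2)] ab(3) by auto
    then have "dist (p a) (p b) < d" by (rule dist_triangle_half_r)
    with neg ab show False by blast
  qed
  moreover have "c ` A \<subseteq> k" using c by blast
  ultimately show False using assms(1) k(1) by (metis finite_imageD finite_subset)
qed

lemma bounded_Union_bounded_gaps:
  fixes C :: "'a::euclidean_space set"
  assumes "compact C"
  shows "bounded (\<Union>(bounded_gaps C))"
proof -
  have "open (- C)" using assms by (simp add: compact_imp_closed open_Compl)
  then have *: "path_components (- C) = components (- C)"
    by (rule path_components_eq_components)
  have "\<Union>(bounded_gaps C) \<subseteq> inside C"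
  proof
    fix x assume "x \<in> \<Union>(bounded_gaps C)"
    then obtain y where y: "x \<in> connected_component_set (- C) y"
        "bounded (connected_component_set (- C) y)"
      unfolding bounded_gaps_def * components_def by auto
    then have "connected_component_set (- C) y = connected_component_set (- C) x"
      using connected_component_eq by metis
    with y show "x \<in> inside C"
      unfolding inside_def using connected_component_in by fastforce
  qed
  moreover have "bounded (inside C)"
    using assms compact_imp_bounded bounded_inside by blast
  ultimately show ?thesis using bounded_subset by blast
qed

lemma thickness_eq_INF:
  fixes C :: "'a::euclidean_space set"
  assumes C: "compact C" and ne: "bounded_gaps C \<noteq> {}"
  shows "thickness C =
    (INF U\<in>bounded_gaps C. ennreal (setdist U
       (\<Union>{V \<in> bounded_gaps C. V \<noteq> U \<and> diameter U \<le> diameter V} \<union> unbounded_gap C)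
         / diameter U))"
    (is "_ = (INF U\<in>_. ennreal (setdist U (?B U) / _))")
proof (cases "\<exists>I G. gap_enumeration C I G")
  case True
  then obtain I G where G: "gap_enumeration C I G" by blast
  show ?thesis
    unfolding thickness_eq_along[OF C ne G] by (rule thickness_along_eq_INF[OF C G])
next
  case False
  have "\<not> (\<forall>e>0. finite {U \<in> bounded_gaps C. e \<le> diameter U})"
  proof
    assume "\<forall>e>0. finite {U \<in> bounded_gaps C. e \<le> diameter U}"
    then have "\<exists>I G. gap_enumeration C I G"
      unfolding gap_enumeration_def
      by (intro decreasing_enumeration bounded_gap_diameter_pos[OF C]) simp_all
    with False show False by blast
  qed
  then obtain e where e: "e > 0" "infinite {U \<in> bounded_gaps C. e \<le> diameter U}" (is "infinite ?A")
    by blast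
  have "\<forall>U\<in>?A. \<exists>x. x \<in> U" using bounded_gap_open[OF C] by blast
  then obtain p where p: "\<And>U. U \<in> ?A \<Longrightarrow> p U \<in> U" by metis
  have bp: "bounded (p ` ?A)"
    by (rule bounded_subset[OF bounded_Union_bounded_gaps[OF C]]) (use p in blast)
  have small: "(INF U\<in>bounded_gaps C. ennreal (setdist U (?B U) / diameter U)) \<le> ennreal (d / e)"
    (is "?R \<le> _") if d: "d > 0" for d
  proof -
    obtain U0 V0 where UV0: "U0 \<in> ?A" "V0 \<in> ?A" "U0 \<noteq> V0" "dist (p U0) (p V0) < d"
      using infinite_bounded_close_pair[OF e(2) bp d] by (elim bexE conjE) (rule that)
    obtain U V where UV: "U \<in> ?A" "V \<in> ?A" "U \<noteq> V" "dist (p U) (p V) < d"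
      and UV_le: "diameter U \<le> diameter V"
    proof (cases "diameter U0 \<le> diameter V0")
      case True
      show ?thesis by (rule that[OF UV0 True])
    next
      case False
      then show ?thesis
        using UV0 by (intro that[of V0 U0]) (auto simp: dist_commute)
    qed
    have "p V \<in> ?B U"
      using UV(2,3) UV_le p[OF UV(2)] by auto
    with p[OF UV(1)] have "setdist U (?B U) \<le> dist (p U) (p V)"
      by (rule setdist_le_dist)
    then have "setdist U (?B U) / diameter U \<le> d / e"
      using UV(1,4) e(1) d by (intro frac_le) auto
    moreover have "?R \<le> ennreal (setdist U (?B U) / diameter U)"
      using UV(1) by (intro INF_lower) auto
    ultimately show ?thesis using order_trans[OF _ ennreal_leI] by blast
  qed
  have "?R \<le> 0"
  proof (rule ennreal_le_epsilon)
    fix x :: real assume "x > 0"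
    then show "?R \<le> 0 + ennreal x"
      using small[of "x * e"] e(1) by simp
  qed
  then have "?R = 0" by (simp only: le_zero_eq)
  moreover have "thickness C = 0"
    unfolding thickness_def by (simp only: ne False if_False)
  ultimately show ?thesis by (simp only:)
qed

end

theory Submission
  imports Defs
begin

text \<open>The proof is a gap-lemma argument in the manner of Newhouse.  Suppose that \<open>C1\<close> and \<open>C2\<close> are
  disjoint, hence at distance \<open>\<delta> > 0\<close> (or one of them is empty, which linkedness excludes), and
  consider pairs \<open>(U, V)\<close> of intersecting bounded gaps of \<open>C1\<close> and \<open>C2\<close>.

  Such pairs exist (\<open>intersecting_bounded_gaps\<close>): the unbounded gaps meet, so a boundary point of
  that of \<open>C1\<close> lies in a bounded gap \<open>V\<close> of \<open>C2\<close>, and then a boundary point of \<open>V\<close> lies in a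
  bounded gap \<open>U\<close> of \<open>C1\<close>.  There are only finitely many of them: the closure of \<open>U\<close> is connected
  and meets both \<open>C1\<close> and \<open>C2\<close>, so \<open>U\<close> has diameter at least \<open>\<delta>\<close>, and so has \<open>V\<close>
  (\<open>setdist_le_diameter_linked_gap\<close>), while a compact set of positive thickness has only finitely
  many gaps of diameter at least \<open>\<delta>\<close> (\<open>finite_large_gaps\<close>).

  Hence some pair minimizes \<open>diameter U + diameter V\<close>.  A point of the boundary of \<open>U\<close> outside \<open>V\<close>
  lies in another gap \<open>V'\<close> of \<open>C2\<close>, which meets \<open>U\<close>.  By minimality \<open>V'\<close> is not a bounded gap
  smaller than \<open>V\<close>; so the definition of thickness bounds the distance from \<open>V\<close> to \<open>V'\<close> below, and
  this distance is at most the diameter of \<open>U\<close>.  Thus the thickness of \<open>C2\<close> is at most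
  \<open>diameter U / diameter V\<close> (\<open>smaller_gap_or_thickness_le\<close>).  Symmetrically the thickness of \<open>C1\<close>
  is at most \<open>diameter V / diameter U\<close>, so the product of the two is at most 1.\<close>

lemma in_gap_if_notin:
  assumes "x \<notin> C"
  shows "x \<in> unbounded_gap C \<or> (\<exists>U\<in>bounded_gaps C. x \<in> U)"
proof -
  let ?P = "path_component_set (- C) x"
  have "x \<in> ?P" "?P \<in> path_components (- C)"
    using assms by (auto simp: path_components_def path_component_refl)
  then show ?thesis
    unfolding unbounded_gap_def bounded_gaps_def by blast
qed

lemma open_gap:
  assumes "compact C" "U \<in> gaps C"
  shows "open U"
  using assms bounded_gap_open(1)[of C U]
  by (auto simp: gaps_def unbounded_gap_eq_outside open_outside compact_imp_closed)

lemma frontier_gap_subset: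
  assumes "compact C" "U \<in> gaps C"
  shows "frontier U \<subseteq> C"
proof (cases "U \<in> bounded_gaps C")
  case True
  have "open (- C)" using assms(1) by (simp add: compact_imp_closed open_Compl)
  then have "U \<in> components (- C)"
    using True path_components_eq_components by (auto simp: bounded_gaps_def)
  then show ?thesis
    using assms(1) frontier_of_components_closed_complement compact_imp_closed by blast
next
  case False
  with assms show ?thesis
    by (auto simp: gaps_def unbounded_gap_eq_outside
        dest: subsetD[OF frontier_outside_subset[OF compact_imp_closed]])
qed

lemma linked_gaps_commute: "linked_gaps U V \<longleftrightarrow> linked_gaps V U"
  by (auto simp: linked_gaps_def)

lemma linked_setsD:
  assumes "linked_sets C1 C2" "U \<in> gaps C1" "V \<in> gaps C2" "U \<inter> V \<noteq> {}"
  shows "linked_gaps U V"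
  using assms by (auto simp: linked_sets_def)

lemma bounded_gap_in_gaps: "U \<in> bounded_gaps C \<Longrightarrow> U \<in> gaps C"
  by (simp add: gaps_def)

text \<open>The only way in which thickness is used: a gap other than \<open>U\<close> that is unbounded or at least
  as large as \<open>U\<close> keeps a distance of at least the thickness times the diameter of \<open>U\<close>.\<close>

lemma thickness_le_dist:
  fixes C :: "'a::euclidean_space set"
  assumes "compact C" "U \<in> bounded_gaps C"
    and W: "W = unbounded_gap C \<or> W \<in> bounded_gaps C \<and> W \<noteq> U \<and> diameter U \<le> diameter W"
    and "x \<in> U" "y \<in> W"
  shows "thickness C \<le> ennreal (dist x y / diameter U)"
proof -
  let ?B = "\<Union>{V \<in> bounded_gaps C. V \<noteq> U \<and> diameter U \<le> diameter V} \<union> unbounded_gap C"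
  have ne: "bounded_gaps C \<noteq> {}" using assms by auto
  have "y \<in> ?B" using W assms by auto
  then have "setdist U ?B \<le> dist x y" using assms by (intro setdist_le_dist)
  then have "setdist U ?B / diameter U \<le> dist x y / diameter U"
    using bounded_gap_diameter_pos[OF assms(1,2)] by (simp add: divide_right_mono)
  moreover have "thickness C \<le> ennreal (setdist U ?B / diameter U)"
    unfolding thickness_eq_INF[OF assms(1) ne] using assms(2) by (rule INF_lower)
  ultimately show ?thesis using order_trans[OF _ ennreal_leI] by blast
qed

text \<open>Infinitely many large gaps in a bounded region would come arbitrarily close to each other,
  against \<open>thickness_le_dist\<close>.\<close>

lemma finite_large_gaps:
  fixes C :: "'a::euclidean_space set"
  assumes C: "compact C" and "thickness C > 0" and e: "e > 0"
  shows "finite {U \<in> bounded_gaps C. e \<le> diameter U}" (is "finite ?A")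
proof (rule ccontr)
  assume inf: "infinite ?A"
  obtain s where s: "0 < s" "s < thickness C" using dense[OF assms(2)] by blast
  then obtain t where "s = ennreal t" "t \<ge> 0" by (cases s) auto
  with s have t: "t > 0" "ennreal t < thickness C" by auto
  have "\<forall>U\<in>?A. \<exists>x. x \<in> U" using bounded_gap_open[OF C] by blast
  then obtain p where p: "\<And>U. U \<in> ?A \<Longrightarrow> p U \<in> U" by metis
  have "bounded (p ` ?A)"
    by (rule bounded_subset[OF bounded_Union_bounded_gaps[OF C]]) (use p in blast)
  from infinite_bounded_close_pair[OF inf this, of "t * e"] t e
  obtain U V where UV: "U \<in> ?A" "V \<in> ?A" "U \<noteq> V" "dist (p U) (p V) < t * e" by auto
  have far: "t * e \<le> dist (p X) (p Y)"
    if "X \<in> ?A" "Y \<in> ?A" "X \<noteq> Y" "diameter X \<le> diameter Y" for X Y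
  proof -
    have "ennreal t \<le> ennreal (dist (p X) (p Y) / diameter X)"
      using thickness_le_dist[OF C, of X Y "p X" "p Y"] that p t by auto
    moreover have pos: "diameter X > 0" using that e by auto
    ultimately have "t * diameter X \<le> dist (p X) (p Y)"
      by (simp add: pos_le_divide_eq)
    moreover have "t * e \<le> t * diameter X" using that t by auto
    ultimately show ?thesis by linarith
  qed
  show False
    using far[of U V] far[of V U] UV by (cases "diameter U \<le> diameter V") (auto simp: dist_commute)
qed

lemma setdist_le_diameter_linked_gap:
  fixes C1 C2 :: "'a::euclidean_space set"
  assumes "compact C1" "compact C2" "U \<in> bounded_gaps C1" "V \<in> gaps C2" "linked_gaps U V"
  shows "setdist C1 C2 \<le> diameter U"
proof -
  obtain u where u: "u \<in> frontier U" "u \<notin> V" using assms by (auto simp: linked_gaps_def)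
  have "connected U"
    using assms(3) path_connected_path_component
    by (auto simp: bounded_gaps_def path_components_def intro: path_connected_imp_connected)
  then have "connected (closure U)" by (rule connected_imp_connected_closure)
  moreover have "closure U \<inter> V \<noteq> {}"
    using assms(5) closure_subset by (fastforce simp: linked_gaps_def)
  moreover have "closure U - V \<noteq> {}" using u by (auto simp: frontier_def)
  ultimately have "closure U \<inter> frontier V \<noteq> {}" by (rule connected_Int_frontier)
  then obtain v where v: "v \<in> closure U" "v \<in> frontier V" by auto
  have "setdist C1 C2 \<le> dist u v"
    using u v frontier_gap_subset[OF assms(1) bounded_gap_in_gaps[OF assms(3)]]
      frontier_gap_subset[OF assms(2,4)] by (intro setdist_le_dist) auto
  also have "\<dots> \<le> diameter (closure U)"
    using u v bounded_gap_open(3)[OF assms(1,3)]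
    by (intro diameter_bounded_bound) (auto simp: frontier_def)
  also have "\<dots> = diameter U"
    using bounded_gap_open(3)[OF assms(1,3)] by (rule diameter_closure)
  finally show ?thesis .
qed

text \<open>Both alternatives come from the gap of \<open>C2\<close> around a boundary point of \<open>U\<close> outside \<open>V\<close>.  If
  that gap is not smaller than \<open>V\<close>, then \<open>U\<close> bridges the distance between the two.\<close>

lemma smaller_gap_or_thickness_le:
  fixes C1 C2 :: "'a::euclidean_space set"
  assumes "compact C1" "compact C2" and disj: "C1 \<inter> C2 = {}"
    and U: "U \<in> bounded_gaps C1" and V: "V \<in> bounded_gaps C2" and link: "linked_gaps U V"
  shows "(\<exists>V'\<in>bounded_gaps C2. U \<inter> V' \<noteq> {} \<and> diameter V' < diameter V) \<or>
    thickness C2 \<le> ennreal (diameter U / diameter V)"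
proof -
  obtain x u where x: "x \<in> U" "x \<in> V" and u: "u \<in> frontier U" "u \<notin> V"
    using link by (auto simp: linked_gaps_def)
  have "u \<notin> C2"
    using u disj frontier_gap_subset[OF assms(1) bounded_gap_in_gaps[OF U]] by auto
  then obtain V' where V': "u \<in> V'" "V' = unbounded_gap C2 \<or> V' \<in> bounded_gaps C2"
    using in_gap_if_notin by metis
  then have "open V'" using assms(2) open_gap by (auto simp: gaps_def)
  moreover have "u \<in> closure U" using u by (auto simp: frontier_def)
  ultimately have meet: "U \<inter> V' \<noteq> {}" using V'(1) open_Int_closure_eq_empty by fastforce
  show ?thesis
  proof (cases "V' \<in> bounded_gaps C2 \<and> diameter V' < diameter V")
    case True
    with meet show ?thesis by blast
  next
    case False
    have "thickness C2 \<le> ennreal (dist x u / diameter V)"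
      by (rule thickness_le_dist[OF assms(2) V _ x(2) V'(1)]) (use False V' u in auto)
    also have "dist x u \<le> diameter (closure U)"
      using x u closure_subset bounded_gap_open(3)[OF assms(1) U]
      by (intro diameter_bounded_bound) (auto simp: frontier_def)
    then have "ennreal (dist x u / diameter V) \<le> ennreal (diameter U / diameter V)"
      using bounded_gap_open(3)[OF assms(1) U] bounded_gap_diameter_pos[OF assms(2) V]
      by (simp add: diameter_closure ennreal_leI divide_right_mono)
    finally show ?thesis by simp
  qed
qed

lemma intersecting_bounded_gaps:
  fixes C1 C2 :: "'a::euclidean_space set"
  assumes C: "compact C1" "compact C2" and disj: "C1 \<inter> C2 = {}" and link: "linked_sets C1 C2"
  shows "\<exists>U\<in>bounded_gaps C1. \<exists>V\<in>bounded_gaps C2. U \<inter> V \<noteq> {}"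
proof -
  let ?E1 = "unbounded_gap C1" and ?E2 = "unbounded_gap C2"
  have E: "?E1 \<in> gaps C1" "?E2 \<in> gaps C2" by (auto simp: gaps_def)
  have "outside (C1 \<union> C2) \<subseteq> ?E1 \<inter> ?E2"
    using C outside_mono[of C1 "C1 \<union> C2"] outside_mono[of C2 "C1 \<union> C2"]
    by (auto simp: unbounded_gap_eq_outside)
  moreover have "outside (C1 \<union> C2) \<noteq> {}"
    using unbounded_gap_nonempty[of "C1 \<union> C2"] C
    by (simp add: unbounded_gap_eq_outside compact_Un)
  ultimately have "linked_gaps ?E1 ?E2" using linked_setsD[OF link E] by blast
  then obtain u where u: "u \<in> frontier ?E1" "u \<notin> ?E2" by (auto simp: linked_gaps_def)
  then have "u \<notin> C2" using frontier_gap_subset[OF C(1) E(1)] disj by auto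
  then obtain V where V: "V \<in> bounded_gaps C2" "u \<in> V" using in_gap_if_notin u by metis
  have "u \<in> closure ?E1" using u by (auto simp: frontier_def)
  then have "?E1 \<inter> V \<noteq> {}"
    using V bounded_gap_open(1)[OF C(2)] open_Int_closure_eq_empty by fastforce
  then have "linked_gaps ?E1 V"
    using linked_setsD[OF link E(1)] V bounded_gap_in_gaps by metis
  then obtain v where v: "v \<in> frontier V" "v \<notin> ?E1" by (auto simp: linked_gaps_def)
  then have "v \<notin> C1"
    using frontier_gap_subset[OF C(2) bounded_gap_in_gaps[OF V(1)]] disj by auto
  then obtain U where U: "U \<in> bounded_gaps C1" "v \<in> U" using in_gap_if_notin v by metis
  have "v \<in> closure V" using v by (auto simp: frontier_def)
  then have "U \<inter> V \<noteq> {}"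
    using U bounded_gap_open(1)[OF C(1)] open_Int_closure_eq_empty by fastforce
  with U V show ?thesis by blast
qed

theorem proposition9:
  fixes C1 C2 :: "'a::euclidean_space set"
  assumes "compact C1" and "compact C2"
    and "linked_sets C1 C2"
    and "thickness C1 * thickness C2 > 1"
  shows "C1 \<inter> C2 \<noteq> {}"
proof
  assume disj: "C1 \<inter> C2 = {}"
  have disj': "C2 \<inter> C1 = {}" using disj by auto
  define P where "P = {(U, V). U \<in> bounded_gaps C1 \<and> V \<in> bounded_gaps C2 \<and> U \<inter> V \<noteq> {}}"
  have P_link: "linked_gaps U V" "linked_gaps V U" if "(U, V) \<in> P" for U V
    using that linked_setsD[OF assms(3)] bounded_gap_in_gaps linked_gaps_commute
    by (fastforce simp: P_def)+
  obtain U0 V0 where P0: "(U0, V0) \<in> P"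
    using intersecting_bounded_gaps[OF assms(1,2) disj assms(3)] by (auto simp: P_def)
  define \<delta> where "\<delta> = setdist C1 C2"
  have "C1 \<noteq> {}" "C2 \<noteq> {}"
    using P_link[OF P0] P0 frontier_gap_subset[OF assms(1)] frontier_gap_subset[OF assms(2)]
      bounded_gap_in_gaps
    by (fastforce simp: P_def linked_gaps_def)+
  then have \<delta>: "\<delta> > 0"
    using assms(1,2) disj setdist_gt_0_compact_closed[of C1 C2] compact_imp_closed
    by (auto simp: \<delta>_def)
  have large: "\<delta> \<le> diameter U" "\<delta> \<le> diameter V" if "(U, V) \<in> P" for U V
    using that P_link[OF that] setdist_le_diameter_linked_gap[OF assms(1,2), of U V]
      setdist_le_diameter_linked_gap[OF assms(2,1), of V U] bounded_gap_in_gaps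
    by (auto simp: P_def \<delta>_def setdist_sym)
  have pos: "thickness C1 > 0" "thickness C2 > 0"
    using assms(4) by (auto simp: zero_less_iff_neq_zero)
  have "P \<subseteq> {U \<in> bounded_gaps C1. \<delta> \<le> diameter U} \<times> {V \<in> bounded_gaps C2. \<delta> \<le> diameter V}"
    using large unfolding P_def by fast
  then have "finite P"
    using finite_large_gaps[OF assms(1) pos(1) \<delta>] finite_large_gaps[OF assms(2) pos(2) \<delta>]
    by (meson finite_SigmaI finite_subset)
  moreover have "P \<noteq> {}" using P0 by blast
  ultimately obtain p where p: "p \<in> P"
    "\<And>q. q \<in> P \<Longrightarrow> diameter (fst p) + diameter (snd p) \<le> diameter (fst q) + diameter (snd q)"
    using ex_is_arg_min_if_finite[of P "\<lambda>p. diameter (fst p) + diameter (snd p)"]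
    unfolding is_arg_min_linorder by blast
  obtain U V where UV: "p = (U, V)" by fastforce
  have U: "U \<in> bounded_gaps C1" and V: "V \<in> bounded_gaps C2" and meet: "U \<inter> V \<noteq> {}"
    using p(1) UV by (auto simp: P_def)
  have min: "diameter U + diameter V \<le> diameter U' + diameter V'" if "(U', V') \<in> P" for U' V'
    using p(2)[OF that] UV by simp
  have dU: "diameter U > 0" and dV: "diameter V > 0"
    using bounded_gap_diameter_pos assms(1,2) U V by blast+
  \<comment> \<open>Minimality rules out the first alternative of \<open>smaller_gap_or_thickness_le\<close>, for \<open>U\<close> and
    for \<open>V\<close>.\<close>
  have "diameter V \<le> diameter V'" if "V' \<in> bounded_gaps C2" "U \<inter> V' \<noteq> {}" for V'
    using min[of U V'] that U by (auto simp: P_def)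
  then have t2: "thickness C2 \<le> ennreal (diameter U / diameter V)"
    using smaller_gap_or_thickness_le[OF assms(1,2) disj U V] P_link p(1) UV
    by (auto simp: not_less[symmetric])
  have "diameter U \<le> diameter U'" if "U' \<in> bounded_gaps C1" "V \<inter> U' \<noteq> {}" for U'
    using min[of U' V] that V by (auto simp: P_def)
  then have t1: "thickness C1 \<le> ennreal (diameter V / diameter U)"
    using smaller_gap_or_thickness_le[OF assms(2,1) disj' V U] P_link p(1) UV
    by (auto simp: not_less[symmetric])
  have "thickness C1 * thickness C2
      \<le> ennreal (diameter V / diameter U) * ennreal (diameter U / diameter V)"
    using t1 t2 by (rule mult_mono) auto
  also have "\<dots> = 1" using dU dV by (simp flip: ennreal_mult)
  finally show False using assms(4) by (simp add: not_less[symmetric])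
qed

end
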